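(* Let $n,k$ be positive integers with $k<n$. For integers $N\ge 1$ and $j$, let $\mathrm{Inc}_j(2\times N)$ be the set of $2\times N$ arrays of positive integers with strictly increasing rows and strictly increasing columns whose set of entries is exactly $\{1,\ldots,2N-j\}$ (this set is empty if $j<0$), and let $\mathrm{RInc}_j(2\times N)$ be the set of $2\times N$ arrays of positive integers with strictly increasing rows, weakly increasing columns (top entry $\le$ bottom entry), and set of entries exactly $\{1,\ldots,2N-j\}$. Put $S_q(N,j)=\sum_{T\in\mathrm{Inc}_j(2\times N)}q^{\mathrm{maj}(T)}$ and $R_q(N,j)=\sum_{T\in\mathrm{RInc}_j(2\times N)}q^{\mathrm{maj}(T)}$. Then \[ R_q(n,k)=S_q(n,k)+S_q(n,k-1)+(1-q^{2n-k})\bigl(S_q(n-1,k-1)+S_q(n-1,k-2)\bigr). \]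
   Context: Rows are numbered from top (row 1) to bottom (row 2). For a two-row array $T$, an integer $i$ is a descent of $T$ if $i$ occurs in row 1 and $i+1$ occurs in row 2; $\mathrm{maj}(T)$ is the sum of all descents of $T$. An empty sum is $0$. *)

theory Defs
  imports Main
begin

text \<open>A two-row array is the pair (row 1, row 2) of its rows, row 1 being the top one.\<close>

type_synonym two_row = "nat list \<times> nat list"

definition entries :: "two_row \<Rightarrow> nat set" where
  "entries T = set (fst T) \<union> set (snd T)"

definition descents :: "two_row \<Rightarrow> nat set" where
  "descents T = {i. i \<in> set (fst T) \<and> i + 1 \<in> set (snd T)}"

definition maj :: "two_row \<Rightarrow> nat" where
  "maj T = \<Sum>(descents T)"

definition strict_rows :: "nat \<Rightarrow> two_row \<Rightarrow> bool" where
  "strict_rows N T \<longleftrightarrow> length (fst T) = N \<and> length (snd T) = N \<and>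
     sorted_wrt (<) (fst T) \<and> sorted_wrt (<) (snd T)"

text \<open>For a negative upper bound \<open>2 N - j\<close> the interval below is empty, as intended.
  Positivity of the entries is part of the condition on the set of entries.\<close>

definition Inc :: "int \<Rightarrow> nat \<Rightarrow> two_row set" where
  "Inc j N = {T. strict_rows N T \<and> (\<forall>c<N. fst T ! c < snd T ! c) \<and>
     entries T = {1..nat (2 * int N - j)}}"

definition RInc :: "int \<Rightarrow> nat \<Rightarrow> two_row set" where
  "RInc j N = {T. strict_rows N T \<and> (\<forall>c<N. fst T ! c \<le> snd T ! c) \<and>
     entries T = {1..nat (2 * int N - j)}}"

definition S :: "'a::comm_ring_1 \<Rightarrow> nat \<Rightarrow> int \<Rightarrow> 'a" where
  "S q N j = (\<Sum>T\<in>Inc j N. q ^ maj T)"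

definition R :: "'a::comm_ring_1 \<Rightarrow> nat \<Rightarrow> int \<Rightarrow> 'a" where
  "R q N j = (\<Sum>T\<in>RInc j N. q ^ maj T)"

lemma Inc_subset_RInc: "Inc j N \<subseteq> RInc j N"
  by (auto simp: Inc_def RInc_def less_imp_le)

lemma finite_RInc: "finite (RInc j N)"
proof (rule finite_subset)
  let ?L = "{xs. set xs \<subseteq> {1..nat (2 * int N - j)} \<and> length xs = N}"
  show "RInc j N \<subseteq> ?L \<times> ?L"
    by (auto simp: RInc_def strict_rows_def entries_def)
  show "finite (?L \<times> ?L)"
    by (intro finite_cartesian_product finite_lists_length_eq finite_atLeastAtMost)
qed

lemma finite_Inc: "finite (Inc j N)"
  using finite_subset[OF Inc_subset_RInc finite_RInc] .

lemma finite_descents: "finite (descents T)"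
  by (rule finite_subset[of _ "set (fst T)"]) (auto simp: descents_def)

lemma RInc_neg:
  assumes "j < 0"
  shows "RInc j N = {}"
proof (rule ccontr)
  assume "RInc j N \<noteq> {}"
  then obtain T where T: "T \<in> RInc j N" by blast
  have "card (entries T) \<le> card (set (fst T)) + card (set (snd T))"
    unfolding entries_def by (rule card_Un_le)
  also have "\<dots> \<le> length (fst T) + length (snd T)"
    by (intro add_mono card_length)
  also have "\<dots> = 2 * N" using T by (simp add: RInc_def strict_rows_def)
  finally show False using T assms by (simp add: RInc_def)
qed

lemma Inc_neg: "j < 0 \<Longrightarrow> Inc j N = {}"
  using Inc_subset_RInc[of j N] RInc_neg[of j N] by simp

end

theory Submission
  imports Defs
begin

text \<open>
  Put \<open>L = 2 n - k\<close> and let \<open>X\<close> be the set of increasing tableaux with \<open>n\<close> entries in the top row,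
  \<open>n - 1\<close> in the bottom row, and entries \<open>1, \<dots>, L\<close>. Deleting the bottom entry of the first column
  with two equal entries is a maj-preserving bijection from the arrays of \<open>RInc\<close> that are not in
  \<open>Inc\<close> onto \<open>X\<close>: the last column of the result whose top entry exceeds the whole preceding part
  of the bottom row (the entries in columns further left) recovers the column.

  Appending \<open>L + 1\<close> to the bottom row maps \<open>X\<close> onto the set indexing \<open>S q n (k - 1)\<close> and raises maj
  by \<open>L\<close> exactly if \<open>L\<close> lies in the top row. Hence the sum over \<open>X\<close> exceeds \<open>S q n (k - 1)\<close> by
  \<open>1 - q ^ L\<close> times the sum over the tableaux in \<open>X\<close> with \<open>L\<close> in the top row. Deleting this \<open>L\<close>
  preserves maj and leaves a \<open>2 \<times> (n - 1)\<close> tableau with largest entry \<open>L - 1\<close> or \<open>L\<close>, as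
  \<open>L\<close> is missing from the bottom row or not.
\<close>

section \<open>Increasing tableaux whose top row may be longer than the bottom row\<close>

definition inc_tab :: "nat \<Rightarrow> nat \<Rightarrow> nat \<Rightarrow> two_row set" where
  "inc_tab a b L = {T. length (fst T) = a \<and> length (snd T) = b \<and>
     sorted_wrt (<) (fst T) \<and> sorted_wrt (<) (snd T) \<and>
     (\<forall>c<b. fst T ! c < snd T ! c) \<and> entries T = {1..L}}"

lemma Inc_eq_inc_tab: "Inc j N = inc_tab N N (nat (2 * int N - j))"
  by (auto simp: Inc_def inc_tab_def strict_rows_def)

lemma finite_inc_tab: "finite (inc_tab a b L)"
proof (rule finite_subset)
  let ?X = "\<lambda>m. {xs. set xs \<subseteq> {1..L} \<and> length xs = m}"
  show "inc_tab a b L \<subseteq> ?X a \<times> ?X b"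
    by (auto simp: inc_tab_def entries_def)
  show "finite (?X a \<times> ?X b)"
    by (intro finite_cartesian_product finite_lists_length_eq finite_atLeastAtMost)
qed

section \<open>Restoring a deleted repeated entry in the bottom row\<close>

definition insert_at :: "nat \<Rightarrow> 'a \<Rightarrow> 'a list \<Rightarrow> 'a list" where
  "insert_at c x ys = take c ys @ x # drop c ys"

lemma length_insert_at: "length (insert_at c x ys) = Suc (length ys)"
  by (simp add: insert_at_def)

lemma set_insert_at: "set (insert_at c x ys) = insert x (set ys)"
proof -
  have "set (take c ys) \<union> set (drop c ys) = set ys"
    by (metis append_take_drop_id set_append)
  then show ?thesis by (auto simp: insert_at_def)
qed

lemma nth_insert_at:
  "c \<le> length ys \<Longrightarrow> i \<le> length ys \<Longrightarrow>
    insert_at c x ys ! i = (if i < c then ys ! i else if i = c then x else ys ! (i - 1))"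
  by (auto simp: insert_at_def nth_append nth_Cons' min_def)

lemma insert_at_inject:
  assumes "insert_at c x ys = insert_at c x zs" "c \<le> length ys"
  shows "ys = zs"
proof -
  have len: "length ys = length zs"
    using arg_cong[OF assms(1), of length] by (simp add: length_insert_at)
  then have "take c ys = take c zs \<and> x # drop c ys = x # drop c zs"
    using assms unfolding insert_at_def by (subst (asm) append_eq_append_conv) auto
  then show ?thesis by (metis append_take_drop_id list.inject)
qed

text \<open>The column in which \<open>insert_at\<close> undoes the deletion of a repeated entry.\<close>

definition split_col :: "nat list \<Rightarrow> nat list \<Rightarrow> nat \<Rightarrow> bool" where
  "split_col A B c \<longleftrightarrow> c \<le> length B \<and> (c = 0 \<or> B ! (c - 1) < A ! c) \<and>
     (\<forall>d. c < d \<and> d \<le> length B \<longrightarrow> A ! d \<le> B ! (d - 1))"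

text \<open>Of two distinct candidates, the larger column \<open>d\<close> would satisfy
  \<open>B ! (d - 1) < A ! d\<close> by its own condition and the opposite by that of the
  smaller.\<close>

lemma split_col_unique:
  assumes "split_col A B c" "split_col A B d"
  shows "c = d"
proof (rule ccontr)
  assume "c \<noteq> d"
  then have "c < d \<or> d < c" by auto
  then show False
    using assms unfolding split_col_def by (metis leD not_less_zero)
qed

text \<open>Column \<open>0\<close> always qualifies, so a last qualifying column exists.\<close>

lemma split_col_exists: "\<exists>c. split_col A B c"
proof -
  let ?C = "{c. c \<le> length B \<and> (c = 0 \<or> B ! (c - 1) < A ! c)}"
  have fin: "finite ?C" by simp
  have mem: "Max ?C \<in> ?C" by (rule Max_in[OF fin]) auto
  have "A ! d \<le> B ! (d - 1)" if "Max ?C < d" "d \<le> length B" for d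
  proof (rule ccontr)
    assume "\<not> ?thesis"
    then have "d \<in> ?C" using that by auto
    then have "d \<le> Max ?C" by (rule Max_ge[OF fin])
    then show False using that by simp
  qed
  then show ?thesis using mem unfolding split_col_def by blast
qed

text \<open>The inverse of deleting the bottom entry of the first column with two equal
  entries.\<close>

definition duplicate :: "two_row \<Rightarrow> two_row" where
  "duplicate T = (let c = (THE c. split_col (fst T) (snd T) c)
     in (fst T, insert_at c (fst T ! c) (snd T)))"

lemma duplicate_eq:
  "split_col A B c \<Longrightarrow> duplicate (A, B) = (A, insert_at c (A ! c) B)"
  unfolding duplicate_def using split_col_unique by (auto simp: Let_def the_equality)

lemma strict_sorted_nth_less:
  "sorted_wrt (<) xs \<Longrightarrow> i < j \<Longrightarrow> j < length xs \<Longrightarrow> xs ! i < (xs ! j :: nat)"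
  by (rule sorted_wrt_nth_less)

lemma strict_sorted_nth_le:
  "sorted_wrt (<) xs \<Longrightarrow> i \<le> j \<Longrightarrow> j < length xs \<Longrightarrow> xs ! i \<le> (xs ! j :: nat)"
  using strict_sorted_nth_less[of xs i j] by (cases "i = j") auto

text \<open>One equivalence serves both directions of the bijection. Deletion moves later bottom
  entries one column to the left, so \<open>A ! i < A ! Suc i\<close> turns weak columns into strict
  ones. Conversely, \<open>split_col\<close> keeps the bottom row increasing up to the inserted
  entry and the columns to its right weakly increasing.\<close>

lemma insert_at_column:
  fixes A B :: "nat list"
  assumes "sorted_wrt (<) A" "length A = Suc (length B)" "c \<le> length B"
  shows "sorted_wrt (<) (insert_at c (A ! c) B) \<and>
      (\<forall>i<length A. A ! i \<le> insert_at c (A ! c) B ! i) \<and>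
      (\<forall>i<c. A ! i < insert_at c (A ! c) B ! i) \<longleftrightarrow>
    sorted_wrt (<) B \<and> (\<forall>i<length B. A ! i < B ! i) \<and> split_col A B c"
    (is "?L \<longleftrightarrow> ?R")
proof
  let ?I = "insert_at c (A ! c) B"
  note I = nth_insert_at[OF assms(3)]
  assume L: ?L
  have lenI: "length ?I = Suc (length B)" by (rule length_insert_at)
  have "B ! i < B ! j" if "i < j" "j < length B" for i j
  proof -
    \<comment> \<open>\<open>i'\<close> and \<open>j'\<close> are the positions in \<open>?I\<close>
      of the entries at \<open>i\<close> and \<open>j\<close> in \<open>B\<close>.\<close>
    define i' where "i' = (if i < c then i else Suc i)"
    define j' where "j' = (if j < c then j else Suc j)"
    have "?I ! i' < ?I ! j'"
      using L lenI that by (intro strict_sorted_nth_less) (auto simp: i'_def j'_def)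
    moreover have "?I ! i' = B ! i" "?I ! j' = B ! j"
      using that by (auto simp: i'_def j'_def I)
    ultimately show ?thesis by simp
  qed
  then have "sorted_wrt (<) B" by (simp add: sorted_wrt_iff_nth_less)
  moreover have "A ! i < B ! i" if "i < length B" for i
  proof (cases "i < c")
    case True
    then have "A ! i < ?I ! i" using L by blast
    then show ?thesis using True that by (simp add: I)
  next
    case False
    have "A ! i < A ! Suc i" using assms that by (intro strict_sorted_nth_less) auto
    also have "\<dots> \<le> ?I ! Suc i" using L assms that by auto
    finally show ?thesis using False that by (simp add: I)
  qed
  moreover have "B ! (c - 1) < A ! c" if "c \<noteq> 0"
  proof -
    have "?I ! (c - 1) < ?I ! c" using L lenI assms that by (intro strict_sorted_nth_less) auto
    then show ?thesis using assms that by (simp add: I)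
  qed
  moreover have "A ! d \<le> B ! (d - 1)" if "c < d" "d \<le> length B" for d
  proof -
    have "A ! d \<le> ?I ! d" using L assms that by simp
    then show ?thesis using that by (simp add: I)
  qed
  ultimately show ?R using assms by (auto simp: split_col_def)
next
  let ?I = "insert_at c (A ! c) B"
  note I = nth_insert_at[OF assms(3)]
  assume R: ?R
  have "?I ! i < ?I ! j" if ij: "i < j" "j \<le> length B" for i j
  proof -
    consider "j < c" | "j = c" | "i < c" "c < j" | "i = c" | "c < i" using ij by linarith
    then show ?thesis
    proof cases
      case 1
      then show ?thesis using R ij strict_sorted_nth_less[of B i j] assms(3) by (simp add: I)
    next
      case 2
      have "B ! i \<le> B ! (c - 1)" using R ij 2 by (intro strict_sorted_nth_le) auto
      also have "\<dots> < A ! c" using R ij 2 by (auto simp: split_col_def)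
      finally show ?thesis using ij 2 by (simp add: I)
    next
      case 3
      have "B ! i < B ! (j - 1)" using R ij 3 by (intro strict_sorted_nth_less) auto
      then show ?thesis using ij 3 by (simp add: I)
    next
      case 4
      have "A ! c < B ! c" using R ij 4 by simp
      also have "B ! c \<le> B ! (j - 1)" using R ij 4 by (intro strict_sorted_nth_le) auto
      finally show ?thesis using ij 4 by (simp add: I)
    next
      case 5
      have "B ! (i - 1) < B ! (j - 1)" using R ij 5 by (intro strict_sorted_nth_less) auto
      then show ?thesis using ij 5 by (simp add: I)
    qed
  qed
  then have "sorted_wrt (<) ?I" by (simp add: sorted_wrt_iff_nth_less length_insert_at)
  moreover have less: "A ! i < ?I ! i" if "i < c" for i
    using R that assms by (simp add: I)
  moreover have "A ! i \<le> ?I ! i" if "i < length A" for i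
  proof -
    consider "i < c" | "i = c" | "c < i" by linarith
    then show ?thesis
    proof cases
      case 1
      then show ?thesis using less[of i] by simp
    qed (use R that assms in \<open>auto simp: I split_col_def\<close>)
  qed
  ultimately show ?L by blast
qed

text \<open>Only \<open>A ! c\<close> joins the bottom row, so a new descent would be a top entry
  \<open>i\<close> with \<open>Suc i = A ! c\<close>. It lies left of column \<open>c\<close>, and
  then \<open>B ! (c - 1)\<close> would lie strictly between \<open>i\<close> and
  \<open>Suc i\<close>.\<close>

lemma maj_insert_at:
  assumes A: "sorted_wrt (<) A" "length A = Suc (length B)"
    and B: "\<forall>i<length B. A ! i < B ! i" and c: "split_col A B c"
  shows "maj (A, insert_at c (A ! c) B) = maj (A, B)"
proof -
  have False if "i \<in> set A" "Suc i = A ! c" for i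
  proof -
    obtain d where d: "d < length A" "A ! d = i" using \<open>i \<in> set A\<close> by (auto simp: in_set_conv_nth)
    have "d < c"
    proof (rule ccontr)
      assume "\<not> d < c"
      then have "A ! c \<le> A ! d" using A d by (intro strict_sorted_nth_le) auto
      then show False using d that by simp
    qed
    then have "i \<le> A ! (c - 1)"
      using A c d by (auto simp: split_col_def intro!: strict_sorted_nth_le)
    also have "\<dots> < B ! (c - 1)" using B c \<open>d < c\<close> by (auto simp: split_col_def)
    finally have "i < B ! (c - 1)" .
    moreover have "B ! (c - 1) < Suc i" using c \<open>d < c\<close> that by (auto simp: split_col_def)
    ultimately show False by simp
  qed
  then have "descents (A, insert_at c (A ! c) B) = descents (A, B)"
    by (auto simp: descents_def set_insert_at)
  then show ?thesis by (simp add: maj_def)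
qed

text \<open>Column \<open>c\<close> becomes the first one with equal entries, so the image
  determines \<open>c\<close>; injectivity of \<open>duplicate\<close> rests on this.\<close>

lemma duplicate_mem:
  assumes T: "(A, B) \<in> inc_tab (Suc n) n (nat (2 * int (Suc n) - j))"
    and c: "split_col A B c"
  shows "duplicate (A, B) \<in> RInc j (Suc n) - Inc j (Suc n)"
    and "maj (duplicate (A, B)) = maj (A, B)"
    and "(LEAST i. A ! i = snd (duplicate (A, B)) ! i) = c"
proof -
  let ?I = "insert_at c (A ! c) B"
  have A: "sorted_wrt (<) A" "length A = Suc (length B)" "length B = n"
    and B: "sorted_wrt (<) B" "\<forall>i<length B. A ! i < B ! i"
    and e: "set A \<union> set B = {1..nat (2 * int (Suc n) - j)}"
    using T by (auto simp: inc_tab_def entries_def)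
  have cn: "c \<le> length B" using c by (simp add: split_col_def)
  have I: "sorted_wrt (<) ?I" "\<forall>i<length A. A ! i \<le> ?I ! i" "\<forall>i<c. A ! i < ?I ! i"
    using insert_at_column[OF A(1,2) cn] B c by blast+
  have Ic: "?I ! c = A ! c" using cn by (simp add: nth_insert_at)
  have "A ! c \<in> set A" using A cn by simp
  then have "set A \<union> set ?I = {1..nat (2 * int (Suc n) - j)}"
    using e by (auto simp: set_insert_at)
  then have "(A, ?I) \<in> RInc j (Suc n)"
    using A I by (simp add: RInc_def strict_rows_def entries_def length_insert_at)
  moreover have "(A, ?I) \<notin> Inc j (Suc n)"
    using Ic cn A by (auto simp: Inc_def intro!: exI[of _ c])
  ultimately show "duplicate (A, B) \<in> RInc j (Suc n) - Inc j (Suc n)"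
    using duplicate_eq[OF c] by simp
  show "maj (duplicate (A, B)) = maj (A, B)"
    using duplicate_eq[OF c] maj_insert_at[OF A(1,2) B(2) c] by simp
  show "(LEAST i. A ! i = snd (duplicate (A, B)) ! i) = c"
    unfolding duplicate_eq[OF c] snd_conv
  proof (rule Least_equality)
    show "A ! c = ?I ! c" using Ic by simp
    show "c \<le> i" if "A ! i = ?I ! i" for i
      using I(3) that by (metis less_irrefl not_le)
  qed
qed

lemma bij_betw_duplicate:
  "bij_betw duplicate (inc_tab (Suc n) n (nat (2 * int (Suc n) - j)))
    (RInc j (Suc n) - Inc j (Suc n))"
  (is "bij_betw _ ?X ?Y")
proof (rule bij_betw_imageI)
  show "inj_on duplicate ?X"
  proof (rule inj_onI)
    fix T T' assume T: "T \<in> ?X" "T' \<in> ?X" and eq: "duplicate T = duplicate T'"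
    obtain A B A' B' where [simp]: "T = (A, B)" "T' = (A', B')" by (cases T, cases T')
    obtain c c' where c: "split_col A B c" "split_col A' B' c'" using split_col_exists by blast
    have [simp]: "A' = A" using eq duplicate_eq[OF c(1)] duplicate_eq[OF c(2)] by simp
    \<comment> \<open>Both are the first column with equal entries of the same array.\<close>
    have "c = c'"
      using duplicate_mem(3)[OF _ c(1)] duplicate_mem(3)[OF _ c(2)] T eq by auto
    then have "insert_at c (A ! c) B = insert_at c (A ! c) B'"
      using eq duplicate_eq[OF c(1)] duplicate_eq[OF c(2)] by simp
    then have "B = B'"
      by (rule insert_at_inject) (use c(1) in \<open>simp add: split_col_def\<close>)
    then show "T = T'" by simp
  qed
next
  have "T \<in> duplicate ` ?X" if "T \<in> ?Y" for T
  proof -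
    obtain A D where [simp]: "T = (A, D)" by (cases T)
    have A: "sorted_wrt (<) A" "length A = Suc n" and D: "sorted_wrt (<) D" "length D = Suc n"
      and le: "\<forall>i<Suc n. A ! i \<le> D ! i"
      and e: "set A \<union> set D = {1..nat (2 * int (Suc n) - j)}"
      using that by (auto simp: RInc_def strict_rows_def entries_def)
    have ex: "\<exists>c. c < Suc n \<and> A ! c = D ! c"
    proof (rule ccontr)
      assume "\<not> ?thesis"
      then have "\<forall>i<Suc n. A ! i < D ! i" using le by (metis le_neq_implies_less)
      then show False using that by (auto simp: RInc_def Inc_def)
    qed
    define c where "c = (LEAST c. c < Suc n \<and> A ! c = D ! c)"
    have c: "c < Suc n" "A ! c = D ! c" using LeastI_ex[OF ex] by (auto simp: c_def)
    have lt: "\<forall>i<c. A ! i < D ! i"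
    proof (intro allI impI)
      fix i assume i: "i < c"
      then have "A ! i \<noteq> D ! i" using not_less_Least[OF i[unfolded c_def]] c(1) by auto
      then show "A ! i < D ! i" using le i c(1) by (simp add: le_neq_implies_less)
    qed
    \<comment> \<open>The preimage is obtained by deleting entry \<open>c\<close> of
      \<open>D\<close>; \<open>insert_at_column\<close>, read from left to right, shows that it is a
      tableau with \<open>split_col A B c\<close>.\<close>
    define B where "B = take c D @ drop (Suc c) D"
    have lenB: "length B = n" using c D by (simp add: B_def)
    have DB: "insert_at c (A ! c) B = D"
      using c D by (simp add: insert_at_def B_def id_take_nth_drop[symmetric])
    have *: "sorted_wrt (<) B \<and> (\<forall>i<length B. A ! i < B ! i) \<and> split_col A B c"
      using insert_at_column[of A B c, unfolded DB] A D(1) c(1) le lt lenB by simp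
    have "A ! c \<in> set A" using A c(1) by simp
    then have "set A \<union> set B = set A \<union> set D"
      using set_insert_at[of c "A ! c" B] by (auto simp: DB)
    then have "(A, B) \<in> ?X" using * A lenB e by (simp add: inc_tab_def entries_def)
    moreover have "T = duplicate (A, B)" using duplicate_eq[of A B c] * DB by simp
    ultimately show ?thesis by (rule rev_image_eqI)
  qed
  moreover have "duplicate T \<in> ?Y" if "T \<in> ?X" for T
    using that split_col_exists duplicate_mem(1) by (cases T) blast
  ultimately show "duplicate ` ?X = ?Y" by blast
qed

lemma R_eq:
  "R q (Suc n) j = S q (Suc n) j +
    (\<Sum>T\<in>inc_tab (Suc n) n (nat (2 * int (Suc n) - j)). q ^ maj T)"
proof -
  let ?X = "inc_tab (Suc n) n (nat (2 * int (Suc n) - j))"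
  let ?Y = "RInc j (Suc n) - Inc j (Suc n)"
  have "(\<Sum>T\<in>?Y. q ^ maj T) = (\<Sum>T\<in>?X. q ^ maj (duplicate T))"
    by (rule sum.reindex_bij_betw[OF bij_betw_duplicate, symmetric])
  also have "\<dots> = (\<Sum>T\<in>?X. q ^ maj T)"
  proof (rule sum.cong[OF refl])
    fix T assume "T \<in> ?X"
    then show "q ^ maj (duplicate T) = q ^ maj T"
      using split_col_exists duplicate_mem(2) by (cases T) metis
  qed
  finally show ?thesis
    unfolding R_def S_def
    by (subst sum.subset_diff[OF Inc_subset_RInc finite_RInc]) (simp add: add.commute)
qed

section \<open>Appending a largest entry to the bottom or the top row\<close>

lemma sorted_wrt_less_snoc:
  "sorted_wrt (<) (xs @ [x]) \<longleftrightarrow> sorted_wrt (<) xs \<and> (\<forall>y\<in>set xs. y < x)"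
  by (auto simp: sorted_wrt_append)

lemma entries_bounds:
  assumes "T \<in> inc_tab a b L" "x \<in> set (fst T) \<or> x \<in> set (snd T)"
  shows "1 \<le> x" "x \<le> L"
proof -
  have "x \<in> {1..L}" using assms by (auto simp: inc_tab_def entries_def)
  then show "1 \<le> x" "x \<le> L" by auto
qed

text \<open>In a rectangular tableau the last bottom entry exceeds every other bottom entry and,
  through the last column, every top entry. Hence it is \<open>Suc L\<close>, occurs only once, and
  its removal leaves exactly \<open>{1..L}\<close>.\<close>

lemma bij_betw_snoc_bottom:
  "bij_betw (\<lambda>T. (fst T, snd T @ [Suc L])) (inc_tab (Suc n) n L) (inc_tab (Suc n) (Suc n) (Suc L))"
  (is "bij_betw ?f ?X ?Y")
proof (rule bij_betw_imageI)
  show "inj_on ?f ?X" by (auto intro!: inj_onI)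
  have "?f T \<in> ?Y" if T: "T \<in> ?X" for T
  proof -
    have "fst T ! n < Suc L"
      using entries_bounds(2)[OF T, of "fst T ! n"] T by (auto simp: inc_tab_def)
    moreover have "\<forall>y\<in>set (snd T). y < Suc L"
      using entries_bounds(2)[OF T] by (auto simp: less_Suc_eq_le)
    moreover have "entries (?f T) = {1..Suc L}"
      using T by (auto simp: inc_tab_def entries_def)
    ultimately show ?thesis
      using T by (auto simp: inc_tab_def sorted_wrt_less_snoc nth_append less_Suc_eq)
  qed
  moreover have "T \<in> ?f ` ?X" if T: "T \<in> ?Y" for T
  proof -
    obtain A D where [simp]: "T = (A, D)" by (cases T)
    have A: "sorted_wrt (<) A" "length A = Suc n" and D: "sorted_wrt (<) D" "length D = Suc n"
      and lt: "\<forall>i<Suc n. A ! i < D ! i" and e: "set A \<union> set D = {1..Suc L}"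
      using T by (auto simp: inc_tab_def entries_def)
    obtain B x where Dx: "D = B @ [x]" using D by (metis length_Suc_conv_rev)
    have lenB: "length B = n" using D Dx by simp
    have B: "sorted_wrt (<) B" "\<forall>y\<in>set B. y < x" using D Dx by (simp_all add: sorted_wrt_less_snoc)
    have Ax: "y < x" if y: "y \<in> set A" for y
    proof -
      obtain i where i: "i < Suc n" "y = A ! i" using y A by (auto simp: in_set_conv_nth)
      then have "y \<le> A ! n" using A by (auto intro: strict_sorted_nth_le)
      also have "\<dots> < x" using lt lenB Dx by (metis lessI nth_append_length)
      finally show ?thesis .
    qed
    have "Suc L \<in> set A \<union> set D" "x \<in> {1..Suc L}" using e Dx by auto
    then have x: "x = Suc L" using Ax B(2) Dx by fastforce
    have "set A \<union> set B = {1..Suc L} - {x}"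
      using e Ax B(2) unfolding Dx by auto
    then have "set A \<union> set B = {1..L}" using x by (simp add: atLeastAtMostSuc_conv)
    moreover have "\<forall>i<n. A ! i < B ! i"
      using lt lenB Dx by (metis less_SucI nth_append)
    ultimately have "(A, B) \<in> ?X"
      using A B lenB by (simp add: inc_tab_def entries_def)
    moreover have "T = ?f (A, B)" using Dx x by simp
    ultimately show ?thesis by (rule rev_image_eqI)
  qed
  ultimately show "?f ` ?X = ?Y" by blast
qed

text \<open>The only possible new descent is \<open>L\<close>, and it was not one before because
  \<open>Suc L\<close> exceeds all entries of \<open>T\<close>.\<close>

lemma maj_snoc_bottom:
  assumes "T \<in> inc_tab a b L"
  shows "maj (fst T, snd T @ [Suc L]) = maj T + (if L \<in> set (fst T) then L else 0)"
proof -
  have "L \<notin> descents T"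
    using entries_bounds(2)[OF assms, of "Suc L"] by (auto simp: descents_def)
  moreover have "descents (fst T, snd T @ [Suc L]) =
      (if L \<in> set (fst T) then insert L (descents T) else descents T)"
    by (auto simp: descents_def)
  ultimately show ?thesis by (simp add: maj_def finite_descents)
qed

text \<open>Each top entry of the rectangular tableau is below its bottom neighbour, which is at
  most \<open>Suc L\<close>; so \<open>Suc L\<close> may be appended on top even if the bottom row
  already contains it. The two sets of the union separate these cases.\<close>

lemma bij_betw_snoc_top:
  "bij_betw (\<lambda>T. (fst T @ [Suc L], snd T)) (inc_tab n n L \<union> inc_tab n n (Suc L))
    {T \<in> inc_tab (Suc n) n (Suc L). Suc L \<in> set (fst T)}"
  (is "bij_betw ?f ?X ?Y")
proof (rule bij_betw_imageI)
  show "inj_on ?f ?X" by (auto intro!: inj_onI)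
  have "?f T \<in> ?Y" if T: "T \<in> ?X" for T
  proof -
    have len: "length (fst T) = n" "length (snd T) = n"
      and s: "sorted_wrt (<) (fst T)" "sorted_wrt (<) (snd T)"
      and lt: "\<forall>i<n. fst T ! i < snd T ! i"
      and e: "entries T = {1..L} \<or> entries T = {1..Suc L}"
      using T by (auto simp: inc_tab_def)
    have "y < Suc L" if y: "y \<in> set (fst T)" for y
    proof -
      obtain i where i: "i < n" "y = fst T ! i" using y len by (auto simp: in_set_conv_nth)
      then have "snd T ! i \<in> entries T" using len by (simp add: entries_def)
      then have "snd T ! i \<le> Suc L" using e by auto
      then show ?thesis using lt i by force
    qed
    moreover have "entries (?f T) = insert (Suc L) (entries T)" by (auto simp: entries_def)
    then have "entries (?f T) = {1..Suc L}" using e by auto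
    ultimately show ?thesis
      using len s lt by (auto simp: inc_tab_def sorted_wrt_less_snoc nth_append)
  qed
  moreover have "T \<in> ?f ` ?X" if T: "T \<in> ?Y" for T
  proof -
    obtain D B where [simp]: "T = (D, B)" by (cases T)
    have D: "sorted_wrt (<) D" "length D = Suc n" and B: "sorted_wrt (<) B" "length B = n"
      and lt: "\<forall>i<n. D ! i < B ! i" and e: "set D \<union> set B = {1..Suc L}"
      and top: "Suc L \<in> set D"
      using T by (auto simp: inc_tab_def entries_def)
    obtain A x where Dx: "D = A @ [x]" using D by (metis length_Suc_conv_rev)
    have lenA: "length A = n" using D Dx by simp
    have A: "sorted_wrt (<) A" "\<forall>y\<in>set A. y < x" using D Dx by (simp_all add: sorted_wrt_less_snoc)
    have "x \<in> {1..Suc L}" using e Dx by auto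
    then have x: "x = Suc L" using top A(2) Dx by fastforce
    have ins: "insert (Suc L) (set A \<union> set B) = {1..Suc L}" using e x Dx by auto
    have "set A \<union> set B = {1..Suc L} \<or> set A \<union> set B = {1..L}"
    proof (cases "Suc L \<in> set A \<union> set B")
      case True
      then show ?thesis using ins by (metis insert_absorb)
    next
      case False
      then have "set A \<union> set B = {1..Suc L} - {Suc L}"
        using ins by (metis Diff_insert_absorb)
      then show ?thesis by (simp add: atLeastAtMostSuc_conv)
    qed
    moreover have "\<forall>i<n. A ! i < B ! i"
      using lt lenA Dx by (metis nth_append)
    ultimately have "(A, B) \<in> ?X"
      using A B lenA by (auto simp: inc_tab_def entries_def)
    moreover have "T = ?f (A, B)" using Dx x by simp
    ultimately show ?thesis by (rule rev_image_eqI)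
  qed
  ultimately show "?f ` ?X = ?Y" by blast
qed

text \<open>A new descent could only be \<open>Suc L\<close>, which would require a bottom entry
  \<open>Suc (Suc L)\<close>.\<close>

lemma maj_snoc_top:
  assumes "T \<in> inc_tab n n L \<union> inc_tab n n (Suc L)"
  shows "maj (fst T @ [Suc L], snd T) = maj T"
proof -
  have "Suc (Suc L) \<notin> set (snd T)"
    using assms entries_bounds(2)[of T n n _ "Suc (Suc L)"] by fastforce
  then have "descents (fst T @ [Suc L], snd T) = descents T"
    by (auto simp: descents_def)
  then show ?thesis by (simp add: maj_def)
qed

section \<open>Combining the bijections into the identity\<close>

lemma sum_inc_tab_eq:
  fixes q :: "'a::comm_ring_1"
  shows "(\<Sum>T\<in>inc_tab (Suc n) n (Suc L). q ^ maj T) =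
    (\<Sum>T\<in>inc_tab (Suc n) (Suc n) (Suc (Suc L)). q ^ maj T) +
    (1 - q ^ Suc L) * ((\<Sum>T\<in>inc_tab n n L. q ^ maj T) + (\<Sum>T\<in>inc_tab n n (Suc L). q ^ maj T))"
proof -
  let ?X = "inc_tab (Suc n) n (Suc L)"
  let ?top = "\<lambda>T. Suc L \<in> set (fst T)"
  have disj: "inc_tab n n L \<inter> inc_tab n n (Suc L) = {}"
    by (auto simp: inc_tab_def)
  have "(\<Sum>T\<in>inc_tab (Suc n) (Suc n) (Suc (Suc L)). q ^ maj T) =
      (\<Sum>T\<in>?X. q ^ maj (fst T, snd T @ [Suc (Suc L)]))"
    by (rule sum.reindex_bij_betw[OF bij_betw_snoc_bottom, symmetric])
  \<comment> \<open>If \<open>Suc L\<close> is on top, appending multiplies the weight by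
    \<open>q ^ Suc L\<close>, that is, it subtracts \<open>1 - q ^ Suc L\<close> times the weight;
    otherwise nothing changes.\<close>
  also have "\<dots> = (\<Sum>T\<in>?X. q ^ maj T - (if ?top T then (1 - q ^ Suc L) * q ^ maj T else 0))"
    by (rule sum.cong[OF refl]) (auto simp: maj_snoc_bottom power_add algebra_simps)
  also have "\<dots> = (\<Sum>T\<in>?X. q ^ maj T) - (1 - q ^ Suc L) * (\<Sum>T | T \<in> ?X \<and> ?top T. q ^ maj T)"
    unfolding sum_subtractf sum_distrib_left
    by (simp add: sum.inter_filter[OF finite_inc_tab] del: power_Suc)
  also have "(\<Sum>T | T \<in> ?X \<and> ?top T. q ^ maj T) =
      (\<Sum>T\<in>inc_tab n n L \<union> inc_tab n n (Suc L). q ^ maj (fst T @ [Suc L], snd T))"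
    by (rule sum.reindex_bij_betw[OF bij_betw_snoc_top, symmetric])
  also have "\<dots> = (\<Sum>T\<in>inc_tab n n L \<union> inc_tab n n (Suc L). q ^ maj T)"
    by (rule sum.cong[OF refl]) (simp add: maj_snoc_top)
  also have "\<dots> = (\<Sum>T\<in>inc_tab n n L. q ^ maj T) + (\<Sum>T\<in>inc_tab n n (Suc L). q ^ maj T)"
    by (rule sum.union_disjoint[OF finite_inc_tab finite_inc_tab disj])
  finally show ?thesis by simp
qed

theorem theorem2p2:
  fixes q :: "'a::comm_ring_1" and n k :: nat
  assumes "0 < k" and "k < n"
  shows "R q n (int k) =
    S q n (int k) + S q n (int k - 1)
      + (1 - q ^ (2 * n - k)) * (S q (n - 1) (int k - 1) + S q (n - 1) (int k - 2))"
proof -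
  obtain m where n: "n = Suc m" using assms by (cases n) auto
  obtain L where L: "2 * n - k = Suc L" using assms by (cases "2 * n - k") auto
  \<comment> \<open>These are the largest entries for the index pairs in the theorem. For
    \<open>k = 1\<close> the last index is \<open>-1\<close>, and \<open>inc_tab m m (Suc L)\<close>
    would need \<open>2 * m + 1\<close> distinct entries in \<open>2 * m\<close> cells, so it is
    empty as intended.\<close>
  have "nat (2 * int n - int k) = Suc L" "nat (2 * int n - (int k - 1)) = Suc (Suc L)"
    "nat (2 * int m - (int k - 1)) = L" "nat (2 * int m - (int k - 2)) = Suc L"
    using L n assms by auto
  then show ?thesis
    using R_eq[of q m "int k"] sum_inc_tab_eq[where n = m and L = L and q = q] L n
    by (simp add: S_def Inc_eq_inc_tab algebra_simps)
qed

end
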